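(* Let $b,c$ be positive integers with $b\le c$ such that either $\nu_2(b)<\nu_2(c)$, or $\nu_2(b)=\nu_2(c)$ and $2^{\nu_2(c-b)}\in[b]$ (so in particular $b<c$). Let $L\ge 0$ be an integer. Then, for $h$ such that $0\le L<2^h$, the limit $$\lim_{h\to\infty}\nu_2(S(c2^h+L,b2^h+L))=\sigma_2(b)-\sigma_2(c)+\nu_2\left(\binom{2c-b}{c}\right)$$ exists and is independent of $L$, and this limit is attained at every $h$ with $L<2^h$ and $2^{h-1+\nu_2(c-b)}\ge\nu_2\left(\binom{2c-b}{c}\right)$.
   Context: $S(n,k)$ is the Stirling number of the second kind; $\sigma_2(m)$ is the sum of the base $2$ digits of $m\ge 0$; $\nu_2$ is the $2$-adic valuation. $[b]$ denotes the set of powers of $2$ occurring in the base $2$ expansion of $b$. *)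

theory Defs
  imports
    Complex_Main
    "HOL-Combinatorics.Stirling"
    "HOL-Computational_Algebra.Computational_Algebra"
begin

(* Only exponents i < m matter: since m < 2 ^ m, all further digits are 0. *)
definition sigma2 :: "nat \<Rightarrow> nat" where
  "sigma2 m = (\<Sum>i<m. (m div 2 ^ i) mod 2)"

abbreviation nu2 :: "nat \<Rightarrow> nat" where
  "nu2 n \<equiv> multiplicity 2 n"

definition binary_powers :: "nat \<Rightarrow> nat set" where
  "binary_powers b = {2 ^ i | i. (b div 2 ^ i) mod 2 = 1}"

(* In the second alternative b < c is explicit because multiplicity 2 0 = 0 in the library,
   while the 2-adic valuation of 0 is infinite, which excludes b = c. *)
definition admissible :: "nat \<Rightarrow> nat \<Rightarrow> bool" where
  "admissible b c \<longleftrightarrow>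
     nu2 b < nu2 c \<or> (nu2 b = nu2 c \<and> b < c \<and> 2 ^ nu2 (c - b) \<in> binary_powers b)"

definition limit_value :: "nat \<Rightarrow> nat \<Rightarrow> int" where
  "limit_value b c = int (sigma2 b) - int (sigma2 c) + int (nu2 ((2 * c - b) choose c))"

end

theory Submission
  imports Defs
begin

text \<open>
  Lagrange inversion of \<open>e\<^sup>t - 1\<close> gives, for \<open>n = k + m\<close>,
  \<open>S(n,k) (k-1)! 2\<^sup>m = (n-1)! [x\<^sup>m] (2x / log (1 + 2x))\<^sup>n\<close>. Since
  \<open>log (1 + 2x) / (2x) = 1 - x \<phi>(x)\<close> with \<open>\<phi> \<equiv> 1\<close> modulo 2, the coefficient is the sum over \<open>d \<le> m\<close> of
  \<open>binom (n+d-1) d\<close> times \<open>[x\<^bsup>m-d\<^esup>] \<phi>\<^sup>d\<close>. For \<open>n = c2\<^sup>h + L\<close> and \<open>m = (c - b)2\<^sup>h\<close>, the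
  hypotheses on \<open>b\<close> and \<open>c\<close> say exactly that the binary digit of \<open>n\<close> at position
  \<open>\<mu> = \<nu>\<^sub>2(m)\<close> is 0, and then the term \<open>d = m\<close> strictly dominates: if \<open>m - d < 2\<^sup>\<mu>\<close>, passing
  from \<open>m\<close> to \<open>d\<close> does not lower the valuation of the binomial coefficient, while \<open>[x\<^bsup>m-d\<^esup>] \<phi>\<^sup>d\<close> is even;
  if \<open>g = m - d \<ge> 2\<^sup>\<mu>\<close>, then \<open>[x\<^sup>g] \<phi>\<^sup>d\<close> has valuation at least \<open>g / 2\<close>, which is where the bound
  \<open>2\<^bsup>\<mu>-1\<^esup>\<close> on the valuation of the binomial coefficient comes in. Legendre's formula for the factorials
  turns the valuation of the dominant term into the stated limit.
\<close>

subsection \<open>Divisibility by powers of 2 in the localization of the integers at 2\<close>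

text \<open>An odd denominator as witness stands in for a valuation on the rationals: 0 qualifies
  for every \<open>k\<close>, and \<open>pow2_dvd 0\<close> means 2-integrality.\<close>

definition pow2_dvd :: "nat \<Rightarrow> rat \<Rightarrow> bool" where
  "pow2_dvd k x \<longleftrightarrow> (\<exists>a b :: int. odd b \<and> x * of_int b = 2 ^ k * of_int a)"

lemma pow2_dvd_0 [simp]: "pow2_dvd k 0"
  unfolding pow2_dvd_def by (rule exI[of _ 0], rule exI[of _ 1]) simp

lemma pow2_dvd_mono:
  assumes "pow2_dvd k x" and "j \<le> k"
  shows "pow2_dvd j x"
proof -
  obtain a b :: int where "odd b" "x * of_int b = 2 ^ k * of_int a"
    using assms(1) by (auto simp: pow2_dvd_def)
  moreover have "(2 :: rat) ^ k = 2 ^ j * 2 ^ (k - j)"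
    using assms(2) by (simp flip: power_add)
  ultimately have "x * of_int b = 2 ^ j * of_int (2 ^ (k - j) * a)"
    by simp
  with \<open>odd b\<close> show ?thesis unfolding pow2_dvd_def by blast
qed

lemma pow2_dvd_mult:
  assumes "pow2_dvd k x" and "pow2_dvd l y"
  shows "pow2_dvd (k + l) (x * y)"
proof -
  obtain a b where 1: "odd (b :: int)" "x * of_int b = 2 ^ k * of_int a"
    using assms(1) by (auto simp: pow2_dvd_def)
  obtain c d where 2: "odd (d :: int)" "y * of_int d = 2 ^ l * of_int c"
    using assms(2) by (auto simp: pow2_dvd_def)
  have "x * y * of_int (b * d) = (x * of_int b) * (y * of_int d)"
    by simp
  also have "\<dots> = 2 ^ (k + l) * of_int (a * c)"
    using 1 2 by (simp add: power_add)
  finally show ?thesis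
    using 1 2 unfolding pow2_dvd_def by (metis even_mult_iff)
qed

lemma pow2_dvd_add:
  assumes "pow2_dvd k x" and "pow2_dvd k y"
  shows "pow2_dvd k (x + y)"
proof -
  obtain a b where 1: "odd (b :: int)" "x * of_int b = 2 ^ k * of_int a"
    using assms(1) by (auto simp: pow2_dvd_def)
  obtain c d where 2: "odd (d :: int)" "y * of_int d = 2 ^ k * of_int c"
    using assms(2) by (auto simp: pow2_dvd_def)
  have "(x + y) * of_int (b * d) = (x * of_int b) * of_int d + (y * of_int d) * of_int b"
    by (simp add: algebra_simps)
  also have "\<dots> = 2 ^ k * of_int (a * d + c * b)"
    unfolding 1 2 by (simp add: algebra_simps)
  finally show ?thesis
    using 1 2 unfolding pow2_dvd_def by (metis even_mult_iff)
qed

lemma pow2_dvd_uminus: "pow2_dvd k x \<Longrightarrow> pow2_dvd k (- x)"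
  unfolding pow2_dvd_def by (metis minus_mult_commute mult_minus_right of_int_minus)

lemma pow2_dvd_diff: "pow2_dvd k x \<Longrightarrow> pow2_dvd k y \<Longrightarrow> pow2_dvd k (x - y)"
  using pow2_dvd_add[of k x "- y"] pow2_dvd_uminus by simp

lemma pow2_dvd_sum: "(\<And>i. i \<in> A \<Longrightarrow> pow2_dvd k (f i)) \<Longrightarrow> pow2_dvd k (\<Sum>i\<in>A. f i)"
  by (induction A rule: infinite_finite_induct) (auto intro: pow2_dvd_add)

lemma pow2_dvd_of_int [simp]: "pow2_dvd k (of_int z) \<longleftrightarrow> 2 ^ k dvd z"
proof
  assume "pow2_dvd k (of_int z)"
  then obtain a b :: int where b: "odd b" "of_int z * of_int b = (2 ^ k * of_int a :: rat)"
    by (auto simp: pow2_dvd_def)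
  have "(of_int (z * b) :: rat) = of_int (2 ^ k * a)"
    using b by simp
  then have "z * b = 2 ^ k * a"
    by (simp only: of_int_eq_iff)
  then have "2 ^ k dvd z * b" by simp
  then show "2 ^ k dvd z"
    using b(1) by (simp add: coprime_dvd_mult_left_iff)
next
  assume "2 ^ k dvd z"
  then obtain a where "z = 2 ^ k * a" by (auto elim: dvdE)
  then show "pow2_dvd k (of_int z)"
    unfolding pow2_dvd_def by (intro exI[of _ a] exI[of _ 1]) simp
qed

lemma pow2_dvd_of_nat [simp]: "pow2_dvd k (of_nat n) \<longleftrightarrow> 2 ^ k dvd n"
proof -
  have "pow2_dvd k (of_nat n) \<longleftrightarrow> pow2_dvd k (of_int (int n))" by simp
  also have "\<dots> \<longleftrightarrow> int (2 ^ k) dvd int n"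
    by (simp only: pow2_dvd_of_int) simp
  finally show ?thesis by (simp only: int_dvd_int_iff)
qed

lemma pow2_dvd_power2: "pow2_dvd k (2 ^ k)"
  using pow2_dvd_of_nat[of k "2 ^ k"] by simp

text \<open>Division by \<open>g\<close> costs only \<open>nu2 g\<close>, because the odd part of
  \<open>g\<close> moves into the denominator.\<close>

lemma pow2_dvd_cancel:
  assumes "pow2_dvd (k + nu2 g) (of_nat g * x)" and "0 < g"
  shows "pow2_dvd k x"
proof -
  obtain a b :: int where b: "odd b" "of_nat g * x * of_int b = 2 ^ (k + nu2 g) * of_int a"
    using assms(1) by (auto simp: pow2_dvd_def)
  obtain h where h: "g = 2 ^ nu2 g * h" "\<not> 2 dvd h"
    using multiplicity_decompose'[of g 2] assms(2) by auto
  have "(of_nat g :: rat) = 2 ^ nu2 g * of_nat h"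
    by (subst h(1)) simp
  then have "2 ^ nu2 g * (x * of_int (int h * b)) = 2 ^ nu2 g * (2 ^ k * of_int a)"
    using b(2) by (simp add: power_add mult_ac)
  then have "x * of_int (int h * b) = 2 ^ k * of_int a" by simp
  moreover have "odd (int h * b)" using h(2) b(1) by simp
  ultimately show ?thesis unfolding pow2_dvd_def by blast
qed

lemma nu2_mult: "0 < x \<Longrightarrow> 0 < y \<Longrightarrow> nu2 (x * y) = nu2 x + nu2 y"
  by (rule prime_elem_multiplicity_mult_distrib) auto

lemma pow2_dvd_iff_le_nu2: "0 < x \<Longrightarrow> 2 ^ k dvd x \<longleftrightarrow> k \<le> nu2 x"
  by (rule power_dvd_iff_le_multiplicity) auto

text \<open>The domination principle: \<open>x\<close> and \<open>y\<close> are divisible by the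
  same powers of 2 up to exponent \<open>Suc (nu2 y)\<close>, which pins down
  \<open>nu2 x\<close>.\<close>

lemma nu2_eq_if_close:
  assumes "0 < y" and "pow2_dvd (Suc (nu2 y)) (of_nat x - of_nat y)"
  shows "nu2 x = nu2 y"
proof -
  have "pow2_dvd (Suc (nu2 y)) (of_int (int x - int y))"
    using assms(2) by simp
  then have d: "2 ^ Suc (nu2 y) dvd int x - int y"
    by (simp only: pow2_dvd_of_int)
  have eq: "2 ^ j dvd x \<longleftrightarrow> 2 ^ j dvd y" if "j \<le> Suc (nu2 y)" for j
  proof -
    have "2 ^ j dvd int x - int y"
      using d that by (meson dvd_trans le_imp_power_dvd)
    then have "2 ^ j dvd int x \<longleftrightarrow> 2 ^ j dvd int y"
      by (metis dvd_diff_right_iff dvd_diff_left_iff)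
    then have "int (2 ^ j) dvd int x \<longleftrightarrow> int (2 ^ j) dvd int y" by simp
    then show ?thesis by (simp only: int_dvd_int_iff)
  qed
  show ?thesis
    using eq[of "nu2 y"] eq[of "Suc (nu2 y)"] pow2_dvd_iff_le_nu2[OF assms(1)]
    by (intro multiplicity_eqI) (auto simp del: power_Suc)
qed

lemma nu2_add:
  fixes x y :: nat
  assumes "nu2 x \<noteq> nu2 y" and "0 < x" and "0 < y"
  shows "nu2 (x + y) = min (nu2 x) (nu2 y)"
proof (cases "nu2 x < nu2 y")
  case True
  then show ?thesis using multiplicity_sum_lt[of 2 x y] assms by simp
next
  case False
  then show ?thesis using multiplicity_sum_lt[of 2 y x] assms by (simp add: add.commute)
qed

text \<open>Follows from 2k <= 2^k; it is the source of the halves in the coefficient bounds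
  below.\<close>

lemma two_nu2_le: "0 < x \<Longrightarrow> 2 * nu2 x \<le> x"
proof -
  assume "0 < x"
  have "2 * k \<le> 2 ^ k" for k :: nat
  proof (induction k)
    case (Suc k)
    then show ?case by (cases k) auto
  qed simp
  also have "2 ^ nu2 x \<le> x"
    using \<open>0 < x\<close> multiplicity_dvd[of 2 x] by (intro dvd_imp_le)
  finally show ?thesis .
qed

subsection \<open>Stirling numbers as coefficients of powers of a logarithmic series\<close>

text \<open>The series \<open>log (1 + 2x) / (2x)\<close>.\<close>

definition log_fps :: "rat fps" where
  "log_fps = Abs_fps (\<lambda>i. (- 2) ^ i / of_nat (Suc i))"

lemma log_fps_nth_0 [simp]: "log_fps $ 0 = 1"
  by (simp add: log_fps_def)

text \<open>\<open>fps_X * log_fps\<close> is log(1 + 2x)/2, whose derivative is 1/(1 + 2x).\<close>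

lemma log_fps_ode: "(1 + 2 * fps_X) * (log_fps + fps_X * fps_deriv log_fps) = 1"
proof -
  have g: "log_fps + fps_X * fps_deriv log_fps = Abs_fps (\<lambda>i. (- 2) ^ i)"
  proof (rule fps_ext)
    fix i
    have "(of_nat (Suc i) :: rat) \<noteq> 0" by (simp only: of_nat_eq_0_iff)
    moreover have "(log_fps + fps_X * fps_deriv log_fps) $ i = of_nat (Suc i) * log_fps $ i"
      unfolding fps_mult_fps_X_deriv_shift by (simp add: algebra_simps)
    ultimately show "(log_fps + fps_X * fps_deriv log_fps) $ i = Abs_fps (\<lambda>i. (- 2) ^ i) $ i"
      by (simp add: log_fps_def del: of_nat_Suc)
  qed
  show ?thesis
    unfolding g
    by (rule fps_ext)
       (auto simp: distrib_right mult.assoc fps_mult_fps_X_commute fps_X_mult_nth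
          numeral_fps_const power_eq_if[of _ "_ :: nat"])
qed

text \<open>With E = \<open>log_fps\<close> and Q = 1/E, the identity Q' = -E'Q^2 turns the previous
  equation times Q^2 into (1 + 2x)(Q - xQ') = Q^2; then multiply by nQ^(n-1).\<close>

lemma log_fps_inverse_power_ode:
  assumes "0 < n"
  shows "(1 + 2 * fps_X) * (of_nat n * inverse log_fps ^ n - fps_X * fps_deriv (inverse log_fps ^ n)) =
    of_nat n * inverse log_fps ^ Suc n"
proof -
  define E where "E = log_fps"
  define Q where "Q = inverse log_fps"
  have EQ: "E * Q = 1"
    by (simp add: E_def Q_def inverse_mult_eq_1')
  have "fps_deriv (E * Q) = 0" by (simp add: EQ)
  then have "(fps_deriv E * Q + E * fps_deriv Q) * Q = 0" by (simp add: mult_ac add_ac)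
  moreover have "(fps_deriv E * Q + E * fps_deriv Q) * Q = fps_deriv E * Q * Q + (E * Q) * fps_deriv Q"
    by (simp add: algebra_simps)
  ultimately have d: "fps_deriv Q = - (fps_deriv E * Q * Q)"
    by (simp add: EQ add_eq_0_iff)
  have "(1 + 2 * fps_X) * (E + fps_X * fps_deriv E) * (Q * Q) = Q * Q"
    using log_fps_ode by (simp add: E_def)
  moreover have "(E + fps_X * fps_deriv E) * (Q * Q) = (E * Q) * Q - fps_X * fps_deriv Q"
    by (simp add: d algebra_simps)
  ultimately have q: "(1 + 2 * fps_X) * (Q - fps_X * fps_deriv Q) = Q * Q"
    by (simp add: EQ mult.assoc)
  obtain k where k: "n = Suc k" using assms by (cases n) auto
  have "(1 + 2 * fps_X) * (of_nat n * Q ^ n - fps_X * fps_deriv (Q ^ n)) =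
      of_nat n * Q ^ k * ((1 + 2 * fps_X) * (Q - fps_X * fps_deriv Q))"
    using fps_deriv_power'[of Q n] by (simp add: k algebra_simps del: of_nat_Suc)
  also have "\<dots> = of_nat n * Q ^ Suc n"
    unfolding q by (simp add: k mult_ac)
  finally show ?thesis by (simp add: Q_def)
qed

text \<open>The operator n - x d/dx multiplies the i-th coefficient by n - i, so this is the
  coefficient of x^m in the differential equation.\<close>

lemma log_fps_inverse_power_rec:
  assumes "0 < n" and "0 < m"
  shows "of_nat n * (inverse log_fps ^ Suc n $ m) =
    (of_nat n - of_nat m) * (inverse log_fps ^ n $ m) +
    2 * (of_nat n - of_nat m + 1) * (inverse log_fps ^ n $ (m - 1))"
proof -
  define F where "F = inverse log_fps ^ n"
  define D where "D = Abs_fps (\<lambda>i. (of_nat n - of_nat i) * F $ i)"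
  have D: "of_nat n * F - fps_X * fps_deriv F = D"
    unfolding fps_mult_fps_X_deriv_shift D_def
    by (rule fps_ext) (simp add: left_diff_distrib fps_of_nat [symmetric])
  have "(1 + 2 * fps_X) * D = D + fps_X * (fps_const 2 * D)"
    by (simp add: numeral_fps_const algebra_simps)
  then have "((1 + 2 * fps_X) * D) $ m = D $ m + 2 * D $ (m - 1)"
    using assms(2) by simp
  moreover have "(1 + 2 * fps_X) * D = of_nat n * inverse log_fps ^ Suc n"
    using log_fps_inverse_power_ode[OF assms(1)] unfolding D[symmetric] F_def .
  moreover have "(of_nat n * inverse log_fps ^ Suc n) $ m = of_nat n * (inverse log_fps ^ Suc n $ m)"
    by (simp only: fps_of_nat[symmetric] fps_mult_left_const_nth)
  ultimately have "of_nat n * (inverse log_fps ^ Suc n $ m) = D $ m + 2 * D $ (m - 1)"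
    by simp
  moreover have "of_nat (m - 1) = (of_nat m - 1 :: rat)"
    using assms(2) by (simp add: of_nat_diff)
  ultimately show ?thesis
    unfolding D_def F_def by (simp del: power_Suc)
qed

text \<open>
  The differential equation of the series yields the recurrence of the Stirling numbers, so no
  inversion theorem is needed.
\<close>

lemma Stirling_eq_log_fps:
  assumes "0 < k" and "k \<le> n"
  shows "of_nat (Stirling n k * fact (k - 1) * 2 ^ (n - k)) =
    of_nat (fact (n - 1)) * (inverse log_fps ^ n $ (n - k))"
  using assms
proof (induction n arbitrary: k)
  case 0
  then show ?case by simp
next
  case (Suc n)
  have q0: "inverse log_fps ^ j $ 0 = 1" for j
    by (simp add: fps_power_zeroth)
  show ?case
  proof (cases "k = Suc n")
    case True
    then show ?thesis by (simp add: q0 del: Stirling.simps)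
  next
    case False
    then obtain j where k: "k = Suc j" "j < n" using Suc.prems by (cases k) auto
    define m where "m = n - j"
    have m: "0 < m" "0 < n" "of_nat n - of_nat m = (of_nat j :: rat)" "n - Suc j = m - 1"
      using k by (auto simp: m_def of_nat_diff)
    have fn: "(of_nat (fact n) :: rat) = of_nat (fact (n - 1)) * of_nat n"
      using m(2) by (simp add: fact_reduce[of n] mult_ac)
    have "of_nat (fact n) * (inverse log_fps ^ Suc n $ m) =
      of_nat (fact (n - 1)) * (of_nat n * (inverse log_fps ^ Suc n $ m))"
      unfolding fn by simp
    also have "\<dots> = of_nat j * (of_nat (fact (n - 1)) * (inverse log_fps ^ n $ m)) +
       2 * of_nat (Suc j) * (of_nat (fact (n - 1)) * (inverse log_fps ^ n $ (m - 1)))"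
      unfolding log_fps_inverse_power_rec[OF m(2,1)] m(3) by (simp add: algebra_simps)
    also have "of_nat (fact (n - 1)) * (inverse log_fps ^ n $ (m - 1)) =
        of_nat (Stirling n (Suc j) * fact j * 2 ^ (m - 1))"
      using Suc.IH[of "Suc j"] k m by simp
    also have "of_nat j * (of_nat (fact (n - 1)) * (inverse log_fps ^ n $ m)) =
        of_nat (Stirling n j * fact j * 2 ^ m)"
    proof (cases j)
      \<comment> \<open>The induction hypothesis needs a positive index; here both sides vanish,
        since \<open>Stirling n 0 = 0\<close> for n > 0.\<close>
      case 0
      then show ?thesis using m(2) by (cases n) auto
    next
      case (Suc i)
      then have "of_nat (Stirling n j * fact i * 2 ^ m) =
        of_nat (fact (n - 1)) * (inverse log_fps ^ n $ m)"
        using Suc.IH[of j] k m_def by simp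
      moreover have "fact j = j * (fact i :: nat)"
        using Suc by simp
      then have "(of_nat (Stirling n j * fact j * 2 ^ m) :: rat) =
          of_nat j * of_nat (Stirling n j * fact i * 2 ^ m)"
        by (simp only: of_nat_mult mult_ac)
      ultimately show ?thesis by (simp only:)
    qed
    finally have "of_nat (fact n) * (inverse log_fps ^ Suc n $ m) =
      of_nat (Stirling n j * fact j * 2 ^ m) +
      2 * of_nat (Suc j) * (of_nat (Stirling n (Suc j) * fact j * 2 ^ (m - 1)) :: rat)" .
    moreover have "(2 :: rat) ^ m = 2 * 2 ^ (m - 1)"
      using m(1) by (cases m) auto
    ultimately show ?thesis
      using k by (simp add: m_def algebra_simps)
  qed
qed

subsection \<open>Valuations of the terms of the expansion\<close>

text \<open>The series \<phi> of the overview; it begins 1 - 4x/3 + 2x^2.\<close>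

definition tail_fps :: "rat fps" where
  "tail_fps = Abs_fps (\<lambda>j. 2 * (- 2) ^ j / of_nat (j + 2))"

lemma log_fps_eq: "log_fps = 1 - fps_X * tail_fps"
proof (rule fps_ext)
  fix i
  show "log_fps $ i = (1 - fps_X * tail_fps) $ i"
    by (cases i) (simp_all add: log_fps_def tail_fps_def)
qed

text \<open>Substitute y = x\<phi> into the negative binomial series of (1 - y)^(-n); the factor x^d
  shifts the coefficient index to m - d.\<close>

lemma log_fps_inverse_power_nth:
  assumes "0 < n"
  shows "inverse log_fps ^ n $ m =
    (\<Sum>d = 0..m. of_nat ((n + d - 1) choose d) * (tail_fps ^ d $ (m - d)))"
proof -
  define Y where "Y = fps_X * tail_fps"
  have Y0: "Y $ 0 = 0" by (simp add: Y_def)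
  have log: "log_fps = (1 - fps_const 1 * fps_X) oo Y"
    using Y0 by (simp add: log_fps_eq Y_def[symmetric] fps_compose_sub_distrib)
  have "log_fps ^ n = (1 - fps_const 1 * fps_X) ^ n oo Y"
    unfolding log by (rule fps_compose_power[OF Y0])
  then have "inverse (log_fps ^ n) = inverse ((1 - fps_const 1 * fps_X) ^ n) oo Y"
    using fps_inverse_compose[OF Y0, of "(1 - fps_const 1 * fps_X) ^ n"]
    by (simp add: fps_power_zeroth)
  then have "inverse log_fps ^ n $ m = (Abs_fps (\<lambda>d. of_nat ((n + d - 1) choose d) * 1 ^ d) oo Y) $ m"
    unfolding one_minus_const_fps_X_neg_power'[OF assms] by (simp add: fps_inverse_power)
  then show ?thesis
    by (simp add: fps_compose_nth Y_def power_mult_distrib fps_X_power_mult_nth)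
qed

text \<open>The numerator contributes j + 1 factors 2, and the denominator j + 2 removes at most
  half of j + 2.\<close>

lemma pow2_dvd_tail_fps: "pow2_dvd ((j + 1) div 2) (tail_fps $ j)"
proof -
  have "pow2_dvd (j + 1) (of_int (2 * (- 2) ^ j))"
    unfolding pow2_dvd_of_int by (simp add: power_minus[of 2])
  moreover have "(j + 1) div 2 + nu2 (j + 2) \<le> j + 1"
    using two_nu2_le[of "j + 2"] by linarith
  ultimately have "pow2_dvd ((j + 1) div 2 + nu2 (j + 2)) (of_int (2 * (- 2) ^ j))"
    by (rule pow2_dvd_mono)
  moreover have "of_nat (j + 2) * tail_fps $ j = of_int (2 * (- 2) ^ j)"
    using of_nat_eq_0_iff[of "j + 2", where 'a = rat]
    by (simp add: tail_fps_def del: of_nat_add)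
  ultimately show ?thesis
    using pow2_dvd_cancel[of "(j + 1) div 2" "j + 2"] by simp
qed

text \<open>For odd j the factor j + 1 from differentiation supplies an extra 2; for even j the
  denominator j + 3 is odd.\<close>

lemma pow2_dvd_deriv_tail_fps: "pow2_dvd ((j + 3) div 2) (fps_deriv tail_fps $ j)"
proof -
  have "pow2_dvd (nu2 (j + 1) + (j + 2)) (of_nat (j + 1) * of_int (2 * (- 2) ^ (j + 1)))"
  proof (rule pow2_dvd_mult)
    show "pow2_dvd (nu2 (j + 1)) (of_nat (j + 1))"
      unfolding pow2_dvd_of_nat by (rule multiplicity_dvd)
    show "pow2_dvd (j + 2) (of_int (2 * (- 2) ^ (j + 1)))"
      unfolding pow2_dvd_of_int by (simp add: power_minus[of 2])
  qed
  moreover have "(j + 3) div 2 + nu2 (j + 3) \<le> nu2 (j + 1) + (j + 2)"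
  proof (cases "even (j + 1)")
    case True
    then have "1 \<le> nu2 (j + 1)"
      using pow2_dvd_iff_le_nu2[of "j + 1" 1] by simp
    then show ?thesis using two_nu2_le[of "j + 3"] by linarith
  next
    case False
    then have "nu2 (j + 3) = 0"
      by (intro not_dvd_imp_multiplicity_0) simp
    then show ?thesis by simp
  qed
  ultimately have "pow2_dvd ((j + 3) div 2 + nu2 (j + 3)) (of_nat (j + 1) * of_int (2 * (- 2) ^ (j + 1)))"
    by (rule pow2_dvd_mono)
  moreover have "of_nat (j + 3) * tail_fps $ (j + 1) = of_int (2 * (- 2) ^ (j + 1))"
    using of_nat_eq_0_iff[of "j + 3", where 'a = rat]
    by (simp add: tail_fps_def numeral_3_eq_3 del: of_nat_add of_nat_Suc)
  then have "of_nat (j + 3) * fps_deriv tail_fps $ j = of_nat (j + 1) * of_int (2 * (- 2) ^ (j + 1))"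
    by (simp only: fps_deriv_nth mult.left_commute)
  ultimately show ?thesis
    using pow2_dvd_cancel[of "(j + 3) div 2" "j + 3"] by simp
qed

text \<open>The bound is j/2 rounded up, which is subadditive in j and therefore survives
  products.\<close>

lemma pow2_dvd_tail_fps_power: "pow2_dvd ((i + 1) div 2) (tail_fps ^ d $ i)"
proof (induction d arbitrary: i)
  case 0
  then show ?case using pow2_dvd_of_nat[of 0 1] by (cases i) auto
next
  case (Suc d)
  have "pow2_dvd ((i + 1) div 2) (tail_fps $ j * tail_fps ^ d $ (i - j))" if "j \<le> i" for j
    using pow2_dvd_mult[OF pow2_dvd_tail_fps[of j] Suc.IH[of "i - j"]]
    by (rule pow2_dvd_mono) (use that in linarith)
  then show ?case
    by (auto simp: fps_mult_nth intro: pow2_dvd_sum)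
qed

text \<open>
  Comparing derivatives gains the factor \<open>d / g\<close> over the previous bound. It also gains half a power
  of 2: the only nonconstant coefficient of minimal valuation is that of \<open>x\<^sup>2\<close>, which the derivative doubles.
\<close>

lemma tail_fps_power_nth_deriv:
  assumes "0 < g"
  obtains y where "of_nat g * tail_fps ^ d $ g = of_nat d * y" and "pow2_dvd ((g + 2) div 2) y"
proof
  \<comment> \<open>From (\<phi>^d)' = d \<phi>' \<phi>^(d-1). For d = 0 the truncated exponent is
    harmless, as the factor d vanishes.\<close>
  let ?y = "(fps_deriv tail_fps * tail_fps ^ (d - 1)) $ (g - 1)"
  have "of_nat g * tail_fps ^ d $ g = fps_deriv (tail_fps ^ d) $ (g - 1)"
    using assms by simp
  also have "\<dots> = (of_nat d * (fps_deriv tail_fps * tail_fps ^ (d - 1))) $ (g - 1)"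
    by (simp only: fps_deriv_power' mult.assoc)
  also have "\<dots> = of_nat d * ?y"
    by (simp only: fps_of_nat[symmetric] fps_mult_left_const_nth)
  finally show "of_nat g * tail_fps ^ d $ g = of_nat d * ?y" .
  have "pow2_dvd ((g + 2) div 2) (fps_deriv tail_fps $ j * tail_fps ^ (d - 1) $ (g - 1 - j))"
    if "j \<le> g - 1" for j
    using pow2_dvd_mult[OF pow2_dvd_deriv_tail_fps[of j] pow2_dvd_tail_fps_power[of "g - 1 - j" "d - 1"]]
    by (rule pow2_dvd_mono) (use that assms in linarith)
  then show "pow2_dvd ((g + 2) div 2) ?y"
    by (auto simp: fps_mult_nth intro: pow2_dvd_sum)
qed

text \<open>The numbers \<open>1 / (g binom N g)\<close> form Leibniz' harmonic triangle, whose rule is the induction step.\<close>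

lemma pow2_dvd_leibniz_triangle:
  assumes "0 < g" and "g \<le> N" and "\<And>j. j < g \<Longrightarrow> nu2 (N - j) \<le> \<mu>"
  shows "pow2_dvd 0 (2 ^ \<mu> / of_nat (g * (N choose g)))"
  using assms
proof (induction g arbitrary: N)
  case 0
  then show ?case by simp
next
  case (Suc g)
  show ?case
  proof (cases "g = 0")
    case True
    have "pow2_dvd (0 + nu2 N) (2 ^ \<mu>)"
      using pow2_dvd_mono[OF pow2_dvd_power2] Suc.prems(3)[of 0] by simp
    then have "pow2_dvd (0 + nu2 N) (of_nat N * (2 ^ \<mu> / of_nat N))"
      using Suc.prems by simp
    then show ?thesis
      using pow2_dvd_cancel[of 0 N] Suc.prems True by simp
  next
    case False
    define a where "a = (N - 1 choose (g - 1))"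
    have gN: "g < N" and a: "0 < a" using Suc.prems False by (auto simp: a_def)
    have 1: "g * (N choose g) = N * a"
      using False binomial_absorption[of "g - 1" N] by (simp add: a_def)
    have 2: "g * (N - 1 choose g) = (N - g) * a"
      using False binomial_absorption[of "g - 1" "N - 1"] binomial_absorb_comp[of "N - 1" "g - 1"] gN
      by (simp add: a_def)
    have 3: "g * (Suc g * (N choose Suc g)) = N * ((N - g) * a)"
      using binomial_absorption[of g N] by (simp only: 2[symmetric] mult.left_commute)
    have "of_nat g * of_nat (Suc g * (N choose Suc g)) = of_nat N * (of_nat (N - g) * (of_nat a :: rat))"
      using 3 by (metis of_nat_mult)
    then have eq: "of_nat (Suc g * (N choose Suc g)) = of_nat N * (of_nat (N - g) * of_nat a) / (of_nat g :: rat)"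
      using False by (simp add: field_simps del: of_nat_mult of_nat_Suc mult_Suc binomial_Suc_Suc)
    have g: "of_nat g = (of_nat N - of_nat (N - g) :: rat)"
      using gN by (simp add: of_nat_diff)
    \<comment> \<open>With x = N, z = N - g and x - z = g this is the triangle rule. For x = z both
      sides are 0 because division by 0 yields 0.\<close>
    have frac: "t / (x * (z * a) / (x - z)) = t / (z * a) - t / (x * a)"
      if "x \<noteq> 0" "z \<noteq> 0" "a \<noteq> 0" for t x z a :: rat
      using that by (cases "x = z") (simp_all add: field_simps)
    have "2 ^ \<mu> / of_nat (Suc g * (N choose Suc g)) =
        2 ^ \<mu> / of_nat ((N - g) * a) - (2 ^ \<mu> / of_nat (N * a) :: rat)"
      unfolding eq g unfolding of_nat_mult using gN a by (intro frac) (simp_all del: of_nat_diff)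
    moreover have "pow2_dvd 0 (2 ^ \<mu> / of_nat ((N - g) * a))"
      unfolding 2[symmetric] using Suc.prems(3)[of "Suc _"] False gN by (intro Suc.IH) auto
    moreover have "pow2_dvd 0 (2 ^ \<mu> / of_nat (N * a))"
      unfolding 1[symmetric] using Suc.prems(3) False gN by (intro Suc.IH) auto
    ultimately show ?thesis by (simp add: pow2_dvd_diff)
  qed
qed

text \<open>Multiplying the 2-integral quotient \<open>2 ^ \<mu> / x\<close> by x shows that the
  2-part of x divides \<open>2 ^ \<mu>\<close>.\<close>

lemma nu2_mult_binomial_le:
  assumes "0 < g" and "g \<le> N" and "\<And>j. j < g \<Longrightarrow> nu2 (N - j) \<le> \<mu>"
  shows "nu2 (g * (N choose g)) \<le> \<mu>"
proof -
  define x where "x = g * (N choose g)"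
  have "0 < x" using assms by (simp add: x_def)
  have "pow2_dvd 0 (2 ^ \<mu> / of_nat x)"
    unfolding x_def by (rule pow2_dvd_leibniz_triangle[OF assms])
  then have "pow2_dvd (nu2 x + 0) (of_nat x * (2 ^ \<mu> / of_nat x))"
    by (intro pow2_dvd_mult) (simp_all add: multiplicity_dvd)
  then have "pow2_dvd (nu2 x) (of_nat (2 ^ \<mu>))"
    using \<open>0 < x\<close> by simp
  then have "2 ^ nu2 x dvd (2 :: nat) ^ \<mu>"
    by (simp only: pow2_dvd_of_nat)
  then show ?thesis
    by (simp add: x_def power_dvd_imp_le)
qed

section \<open>Comparison of the terms of the expansion with the term d = m\<close>

lemma mult_binomial_shift:
  fixes n d :: nat
  assumes "0 < d"
  shows "d * ((n + d - 1) choose d) = n * ((n + d - 1) choose (d - 1))"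
  using binomial_absorption[of "d - 1" "n + d - 1"] binomial_absorb_comp[of "n + d - 1" "d - 1"] assms
  by simp

text \<open>The hypothesis says that the binary digit of n at position \<mu> is 0, whereas the digit
  at position \<open>nu2 n\<close> is 1.\<close>

lemma nu2_neq_if_bit_zero:
  assumes "n mod 2 ^ Suc \<mu> < 2 ^ \<mu>" and "0 < n"
  shows "nu2 n \<noteq> \<mu>"
proof
  assume eq: "nu2 n = \<mu>"
  then have "2 ^ \<mu> dvd n mod 2 ^ Suc \<mu>"
    using multiplicity_dvd[of 2 n] by (simp add: dvd_mod)
  then have "n mod 2 ^ Suc \<mu> = 0"
    using assms(1) by (meson nat_dvd_not_less neq0_conv)
  then have "2 ^ Suc \<mu> dvd n" by (simp only: mod_eq_0_iff_dvd)
  then show False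
    using eq assms(2) pow2_dvd_iff_le_nu2[of n "Suc \<mu>"] by simp
qed

text \<open>The quotient of the two coefficients is n/(n + m), and \<open>nu2 (n + m)\<close> is the
  minimum of two distinct valuations. The subtraction is truncated: it gives 0 if
  \<open>nu2 n < nu2 m\<close>.\<close>

lemma nu2_binomial_shift:
  assumes "0 < n" and "0 < m" and "n mod 2 ^ Suc (nu2 m) < 2 ^ nu2 m"
  shows "nu2 ((n + m - 1) choose m) = nu2 ((n + m) choose m) + (nu2 n - nu2 m)"
proof -
  have "n * ((n + m) choose m) = (n + m) * ((n + m - 1) choose m)"
    using binomial_absorb_comp[of "n + m" m] by simp
  then have "nu2 n + nu2 ((n + m) choose m) = nu2 (n + m) + nu2 ((n + m - 1) choose m)"
    using assms by (simp add: nu2_mult[symmetric])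
  moreover have "nu2 (n + m) = min (nu2 n) (nu2 m)"
    using nu2_neq_if_bit_zero[OF assms(3,1)] assms(1,2) by (rule nu2_add)
  ultimately show ?thesis by linarith
qed

text \<open>With N = n + m - 1, binom(N,m) binom(m,g) = binom(N,g) binom(N-g,m-g). Here binom(m,g)
  has valuation at least \<open>\<mu> - nu2 g\<close>, and binom(N,g) at most that.\<close>

lemma nu2_binomial_le_near:
  assumes "0 < n" and "0 < m" and "n mod 2 ^ Suc (nu2 m) < 2 ^ nu2 m"
    and "0 < g" and "g < 2 ^ nu2 m"
  shows "nu2 ((n + m - 1) choose m) \<le> nu2 ((n + (m - g) - 1) choose (m - g))"
proof -
  define \<mu> where "\<mu> = nu2 m"
  define N where "N = n + m - 1"
  have "2 ^ \<mu> \<le> m"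
    using assms(2) multiplicity_dvd[of 2 m] unfolding \<mu>_def by (intro dvd_imp_le)
  then have g: "g < m" "g \<le> N"
    using assms by (auto simp: \<mu>_def N_def)
  obtain q where q: "m = 2 ^ \<mu> * q" "odd q"
    using multiplicity_decompose'[of m 2] assms(2) by (auto simp: \<mu>_def)
  define r where "r = int (n mod 2 ^ Suc \<mu>)"
  \<comment> \<open>Modulo 2^(\<mu>+1), m is 2^\<mu>, so N - j is congruent to r + 2^\<mu> - j - 1;
    this lies strictly between 0 and 2^(\<mu>+1), as r and j + 1 are below 2^\<mu>.\<close>
  have "nu2 (N - j) \<le> \<mu>" if "j < g" for j
  proof (rule ccontr)
    assume "\<not> nu2 (N - j) \<le> \<mu>"
    then have "2 ^ Suc \<mu> dvd N - j" by (intro multiplicity_dvd') simp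
    then have "int (2 ^ Suc \<mu>) dvd int (N - j)" by (simp only: int_dvd_int_iff)
    moreover have "int (N - j) = int (2 ^ Suc \<mu>) * int (n div 2 ^ Suc \<mu> + q div 2) +
        (r + 2 ^ \<mu> - int j - 1)"
    proof -
      have "int n = int (2 ^ Suc \<mu>) * int (n div 2 ^ Suc \<mu>) + r"
        unfolding r_def by (simp only: of_nat_mult[symmetric] of_nat_add[symmetric] mult_div_mod_eq)
      moreover have "q = 2 * (q div 2) + 1"
        using q(2) by simp
      then have "int m = 2 ^ \<mu> * (2 * int (q div 2) + 1)"
        using q(1) by (metis of_nat_1 of_nat_add of_nat_mult of_nat_numeral of_nat_power)
      moreover have "int (N - j) = int n + int m - int j - 1"
        using that g assms(1) by (simp add: N_def of_nat_diff)
      ultimately show ?thesis by (simp add: algebra_simps)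
    qed
    ultimately have "int (2 ^ Suc \<mu>) dvd (r + 2 ^ \<mu> - int j - 1)"
      by (metis dvd_add_right_iff dvd_triv_left)
    moreover have "0 \<le> r" by (simp add: r_def)
    moreover have "r < 2 ^ \<mu>"
      using assms(3) unfolding r_def \<mu>_def by (metis of_nat_less_iff of_nat_numeral of_nat_power)
    moreover have "int j + 1 < 2 ^ \<mu>"
      using that assms(5) unfolding \<mu>_def
      by (metis Suc_eq_plus1 Suc_leI le_less_trans of_nat_1 of_nat_add of_nat_less_iff of_nat_numeral of_nat_power)
    ultimately show False
      by (auto dest!: zdvd_imp_le)
  qed
  then have "nu2 (g * (N choose g)) \<le> \<mu>"
    using assms(4) g by (intro nu2_mult_binomial_le)
  then have 1: "nu2 g + nu2 (N choose g) \<le> \<mu>"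
    using assms(4) g by (simp add: nu2_mult)
  have "g * (m choose g) = m * (m - 1 choose (g - 1))"
    using binomial_absorption[of "g - 1" m] assms(4) by simp
  then have "nu2 g + nu2 (m choose g) = \<mu> + nu2 (m - 1 choose (g - 1))"
    using assms(2,4) g by (simp add: nu2_mult[symmetric] \<mu>_def)
  moreover have "(N choose m) * (m choose g) = (N choose g) * ((N - g) choose (m - g))"
    using g assms(1) by (intro choose_mult) (auto simp: N_def)
  then have "nu2 (N choose m) + nu2 (m choose g) = nu2 (N choose g) + nu2 ((N - g) choose (m - g))"
    using g assms(1) by (simp add: nu2_mult[symmetric] N_def)
  moreover have "N - g = n + (m - g) - 1"
    using g by (simp add: N_def)
  ultimately show ?thesis
    using 1 unfolding N_def[symmetric] by simp
qed

text \<open>With g = m - d: for g < 2^\<mu> the binomial coefficient suffices up to one factor 2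
  from \<phi>^d. For larger g the binomial coefficient supplies only the excess \<delta> of
  \<open>nu2 n\<close> over \<mu>, and \<phi>^d the rest; if \<open>nu2 d > \<mu>\<close>, even
  \<delta> requires the factor d/g from differentiation.\<close>

lemma pow2_dvd_minor_term:
  assumes n: "0 < n" and bit: "n mod 2 ^ Suc (nu2 m) < 2 ^ nu2 m"
    and e: "2 * nu2 ((n + m) choose m) \<le> 2 ^ nu2 m" and d: "d < m"
  shows "pow2_dvd (Suc (nu2 ((n + m - 1) choose m)))
    (of_nat ((n + d - 1) choose d) * tail_fps ^ d $ (m - d))"
proof (cases "d = 0")
  case True
  then show ?thesis using d by simp
next
  case False
  define g where "g = m - d"
  define \<mu> where "\<mu> = nu2 m"
  define e where "e = nu2 ((n + m) choose m)"
  define \<delta> where "\<delta> = nu2 n - \<mu>"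
  define C where "C = (n + d - 1) choose d"
  have pos: "0 < m" "0 < g" "0 < d" "d = m - g" "0 < C"
    using d False n by (auto simp: g_def C_def)
  have e': "nu2 ((n + m - 1) choose m) = e + \<delta>"
    unfolding e_def \<delta>_def \<mu>_def by (rule nu2_binomial_shift[OF n pos(1) bit])
  have dC: "d * C = n * ((n + d - 1) choose (d - 1))"
    unfolding C_def using pos(3) by (rule mult_binomial_shift)
  have nuC: "nu2 n \<le> nu2 d + nu2 C"
  proof -
    have "nu2 (d * C) = nu2 n + nu2 ((n + d - 1) choose (d - 1))"
      unfolding dC using n by (intro nu2_mult) auto
    then show ?thesis using pos(3,5) by (simp add: nu2_mult)
  qed
  have C_dvd: "pow2_dvd (nu2 C) (of_nat C)"
    by (simp add: multiplicity_dvd)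
  have "pow2_dvd (Suc (e + \<delta>)) (of_nat C * tail_fps ^ d $ g)"
  proof (cases "g < 2 ^ \<mu>")
    case True
    have "e + \<delta> \<le> nu2 C"
      using nu2_binomial_le_near[OF n pos(1) bit pos(2)] True pos(4) e' by (simp add: \<mu>_def C_def)
    then show ?thesis
      using pow2_dvd_mono[OF pow2_dvd_mult[OF C_dvd pow2_dvd_tail_fps_power]] pos(2) by simp
  next
    case False
    show ?thesis
    proof (cases "nu2 d \<le> \<mu>")
      case True
      \<comment> \<open>Strictness yields the extra factor 2. If g were 2^\<mu>, then d and m would
        be consecutive multiples of 2^\<mu>, so one of them would be divisible by
        2^(\<mu>+1).\<close>
      have "g \<noteq> 2 ^ \<mu>"
      proof
        assume "g = 2 ^ \<mu>"
        then have m: "m = d + 2 ^ \<mu>" using d by (simp add: g_def)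
        have "2 ^ \<mu> dvd m"
          unfolding \<mu>_def by (rule multiplicity_dvd)
        then have "2 ^ \<mu> dvd d" unfolding m by simp
        then obtain q where q: "d = 2 ^ \<mu> * q" by (rule dvdE)
        have "even q \<or> even (q + 1)" by simp
        then show False
        proof
          assume "even q"
          then have "2 ^ Suc \<mu> dvd d" using q by simp
          then show False using True pos(3) pow2_dvd_iff_le_nu2[of d "Suc \<mu>"] by simp
        next
          assume "even (q + 1)"
          then have "2 ^ \<mu> * 2 dvd 2 ^ \<mu> * (q + 1)" by (intro mult_dvd_mono) simp_all
          then have "2 ^ Suc \<mu> dvd m" using q m by (simp add: algebra_simps)
          then show False using pos(1) pow2_dvd_iff_le_nu2[of m "Suc \<mu>"] by (simp add: \<mu>_def)
        qed
      qed
      then have "Suc e \<le> (g + 1) div 2"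
        using False e unfolding e_def \<mu>_def by linarith
      moreover have "\<delta> \<le> nu2 C"
        using nuC True by (simp add: \<delta>_def)
      ultimately show ?thesis
        using pow2_dvd_mono[OF pow2_dvd_mult[OF C_dvd pow2_dvd_tail_fps_power[of g d]]] by simp
    next
      case nd: False
      obtain y where y: "of_nat g * tail_fps ^ d $ g = of_nat d * y" "pow2_dvd ((g + 2) div 2) y"
        using tail_fps_power_nth_deriv[OF pos(2)] .
      \<comment> \<open>Since m = d + g and \<open>nu2 d\<close> exceeds \<open>nu2 m\<close>, the
        valuation of m must come from g.\<close>
      have "nu2 g = \<mu>"
      proof (rule ccontr)
        assume "nu2 g \<noteq> \<mu>"
        have "m = d + g" using d by (simp add: g_def)
        show False
        proof (cases "nu2 g = nu2 d")
          case True
          then have "2 ^ Suc \<mu> dvd g" "2 ^ Suc \<mu> dvd d"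
            using nd by (auto intro!: multiplicity_dvd' simp del: power_Suc)
          then have "2 ^ Suc \<mu> dvd m" unfolding \<open>m = d + g\<close> by (rule dvd_add[rotated])
          then show False using pos(1) pow2_dvd_iff_le_nu2[of m "Suc \<mu>"] by (simp add: \<mu>_def)
        next
          case False
          then have "nu2 (d + g) = min (nu2 d) (nu2 g)"
            using pos(2,3) by (intro nu2_add) auto
          then have "\<mu> = min (nu2 d) (nu2 g)"
            by (simp add: \<mu>_def \<open>m = d + g\<close>)
          then show False
            using nd \<open>nu2 g \<noteq> \<mu>\<close> by linarith
        qed
      qed
      have "Suc e \<le> (g + 2) div 2"
        using False e unfolding e_def \<mu>_def by linarith
      \<comment> \<open>d * C is a multiple of both n and d, and \<mu> + \<delta> is the maximum of
        \<mu> and \<open>nu2 n\<close>.\<close>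
      moreover have "\<mu> + \<delta> \<le> nu2 (d * C)"
        using nuC nd pos by (auto simp: nu2_mult \<delta>_def)
      moreover have "pow2_dvd (nu2 (d * C) + (g + 2) div 2) (of_nat (d * C) * y)"
        using y(2) by (intro pow2_dvd_mult) (simp_all only: pow2_dvd_of_nat multiplicity_dvd)
      ultimately have "pow2_dvd (Suc (e + \<delta>) + nu2 g) (of_nat (d * C) * y)"
        using \<open>nu2 g = \<mu>\<close> by (elim pow2_dvd_mono) simp
      moreover have "of_nat g * (of_nat C * tail_fps ^ d $ g) = of_nat C * (of_nat g * tail_fps ^ d $ g)"
        by (rule mult.left_commute)
      then have "of_nat g * (of_nat C * tail_fps ^ d $ g) = of_nat (d * C) * y"
        unfolding y(1) by (simp only: of_nat_mult mult_ac)
      ultimately have "pow2_dvd (Suc (e + \<delta>) + nu2 g) (of_nat g * (of_nat C * tail_fps ^ d $ g))"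
        by (simp only:)
      then show ?thesis
        using pos(2) by (rule pow2_dvd_cancel)
    qed
  qed
  then show ?thesis unfolding e' unfolding C_def g_def .
qed

lemma Stirling_pos: "0 < k \<Longrightarrow> k \<le> n \<Longrightarrow> 0 < Stirling n k"
proof (induction n arbitrary: k)
  case (Suc n)
  then obtain j where j: "k = Suc j" "j \<le> n" by (cases k) auto
  show ?case
  proof (cases "j = 0")
    case True
    then show ?thesis using j by (simp del: Stirling.simps)
  next
    case False
    then show ?thesis using Suc.IH[of j] j by simp
  qed
qed simp

text \<open>The Stirling side x differs from the dominant term y by the minor terms R times a
  factorial, which have strictly larger valuation than y.\<close>

lemma nu2_Stirling:
  assumes k: "0 < k" and n: "n = k + m" and m: "0 < m"
    and bit: "n mod 2 ^ Suc (nu2 m) < 2 ^ nu2 m"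
    and e: "2 * nu2 ((n + m) choose m) \<le> 2 ^ nu2 m"
  shows "nu2 (Stirling n k) + nu2 (fact (k - 1) :: nat) + m =
    nu2 (fact (n - 1) :: nat) + nu2 ((n + m - 1) choose m)"
proof -
  define C where "C = (n + m - 1) choose m"
  define R where "R = (\<Sum>d = 0..<m. of_nat ((n + d - 1) choose d) * (tail_fps ^ d $ (m - d)))"
  define x where "x = Stirling n k * fact (k - 1) * 2 ^ m"
  define y where "y = fact (n - 1) * C"
  have n0: "0 < n" using k n by simp
  have C: "0 < C" using n0 by (simp add: C_def)
  \<comment> \<open>The term d = m is exactly C, because \<phi>^m has constant coefficient
    1.\<close>
  have Q: "inverse log_fps ^ n $ m = R + of_nat C"
    unfolding log_fps_inverse_power_nth[OF n0] R_def C_def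
    by (simp add: atLeastLessThanSuc_atLeastAtMost[symmetric] fps_power_zeroth tail_fps_def)
  have R: "pow2_dvd (Suc (nu2 C)) R"
    unfolding R_def C_def using pow2_dvd_minor_term[OF n0 bit e] by (intro pow2_dvd_sum) auto
  have "n - k = m" using n by simp
  then have "of_nat x = of_nat (fact (n - 1)) * (inverse log_fps ^ n $ m)"
    using Stirling_eq_log_fps[of k n] k n by (simp add: x_def)
  then have "(of_nat x :: rat) - of_nat y = of_nat (fact (n - 1)) * R"
    unfolding Q y_def of_nat_mult by (simp only: distrib_left add_diff_cancel_right')
  moreover have "pow2_dvd (nu2 (fact (n - 1)) + Suc (nu2 C)) (of_nat (fact (n - 1)) * R)"
    using R by (intro pow2_dvd_mult) (simp_all only: pow2_dvd_of_nat multiplicity_dvd)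
  moreover have nuy: "nu2 y = nu2 (fact (n - 1) :: nat) + nu2 C"
    unfolding y_def using C by (intro nu2_mult) simp_all
  ultimately have "nu2 x = nu2 y"
    using C by (intro nu2_eq_if_close) (simp_all add: y_def)
  moreover have "nu2 x = nu2 (Stirling n k) + nu2 (fact (k - 1) :: nat) + m"
    unfolding x_def using Stirling_pos[OF k, of n] n by (simp add: nu2_mult)
  ultimately show ?thesis using nuy by (simp add: C_def)
qed

subsection \<open>Binary digit sums\<close>

lemma sigma2_eq_sum:
  assumes "m \<le> N"
  shows "sigma2 m = (\<Sum>i<N. (m div 2 ^ i) mod 2)"
proof -
  have "m div 2 ^ i = 0" if "m \<le> i" for i
    using that less_exp[of i] by (intro div_less) linarith
  then show ?thesis
    unfolding sigma2_def using assms by (intro sum.mono_neutral_left) auto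
qed

lemma sigma2_double_add:
  assumes "r < 2"
  shows "sigma2 (2 * m + r) = sigma2 m + r"
proof -
  have "sigma2 (2 * m + r) = (\<Sum>i<Suc (2 * m + r). ((2 * m + r) div 2 ^ i) mod 2)"
    by (rule sigma2_eq_sum) simp
  also have "\<dots> = r + (\<Sum>i<2 * m + r. ((2 * m + r) div 2 ^ Suc i) mod 2)"
    unfolding sum.lessThan_Suc_shift using assms by simp
  also have "(\<Sum>i<2 * m + r. ((2 * m + r) div 2 ^ Suc i) mod 2) = (\<Sum>i<2 * m + r. (m div 2 ^ i) mod 2)"
    unfolding power_Suc div_mult2_eq using assms by simp
  also have "\<dots> = sigma2 m"
    by (rule sigma2_eq_sum[symmetric]) simp
  finally show ?thesis by simp
qed

text \<open>The digits of b and L occupy disjoint positions; this makes L cancel from the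
  limit.\<close>

lemma sigma2_concat:
  assumes "L < 2 ^ h"
  shows "sigma2 (b * 2 ^ h + L) = sigma2 b + sigma2 L"
  using assms
proof (induction h arbitrary: L)
  case 0
  then show ?case by (simp add: sigma2_def)
next
  case (Suc h)
  have "b * 2 ^ Suc h + L = 2 * (b * 2 ^ h + L div 2) + L mod 2"
    by simp
  then have "sigma2 (b * 2 ^ Suc h + L) = sigma2 (b * 2 ^ h + L div 2) + L mod 2"
    by (simp only: sigma2_double_add mod_less_divisor zero_less_numeral)
  also have "\<dots> = sigma2 b + (sigma2 (L div 2) + L mod 2)"
    using Suc by simp
  also have "sigma2 (L div 2) + L mod 2 = sigma2 L"
    using sigma2_double_add[of "L mod 2" "L div 2"] by simp
  finally show ?case .
qed

text \<open>Adding 1 turns \<open>nu2 (Suc n)\<close> trailing ones into zeros and the next zero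
  into a one.\<close>

lemma nu2_Suc_sigma2: "nu2 (Suc n) + sigma2 (Suc n) = Suc (sigma2 n)"
proof (induction n rule: less_induct)
  case (less n)
  define a where "a = n div 2"
  show ?case
  proof (cases "even n")
    case True
    then have n: "n = 2 * a" by (simp add: a_def)
    have "nu2 (Suc n) = 0"
      using True by (intro not_dvd_imp_multiplicity_0) simp
    then show ?thesis
      using sigma2_double_add[of 0 a] sigma2_double_add[of 1 a] by (simp add: n)
  next
    case False
    then have n: "n = 2 * a + 1" by (simp add: a_def)
    have "nu2 (2 * Suc a) = 1 + nu2 (Suc a)"
      by (subst nu2_mult) simp_all
    moreover have "Suc n = 2 * Suc a" by (simp add: n)
    ultimately show ?thesis
      using sigma2_double_add[of 0 "Suc a"] sigma2_double_add[of 1 a] less[of a] n by simp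
  qed
qed

text \<open>Legendre's formula, stated additively to avoid truncated subtraction.\<close>

lemma nu2_fact: "nu2 (fact n :: nat) + sigma2 n = n"
proof (induction n)
  case 0
  then show ?case by (simp add: sigma2_def)
next
  case (Suc n)
  have "nu2 (fact (Suc n) :: nat) = nu2 (Suc n) + nu2 (fact n :: nat)"
    unfolding fact_Suc of_nat_id by (rule nu2_mult) simp_all
  then show ?case using Suc nu2_Suc_sigma2[of n] by simp
qed

lemma nu2_binomial: "nu2 ((x + y) choose x) + sigma2 (x + y) = sigma2 x + sigma2 y"
proof -
  have "fact x * fact y * ((x + y) choose x) = (fact (x + y) :: nat)"
    using binomial_fact_lemma[of x "x + y"] by simp
  then have "nu2 (fact x :: nat) + nu2 (fact y :: nat) + nu2 ((x + y) choose x) = nu2 (fact (x + y) :: nat)"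
    by (metis binomial_eq_0_iff fact_gt_zero le_add1 linorder_not_less mult_pos_pos neq0_conv nu2_mult)
  then show ?thesis
    using nu2_fact[of x] nu2_fact[of y] nu2_fact[of "x + y"] by linarith
qed

lemma nu2_fact_pred: "0 < n \<Longrightarrow> nu2 n + nu2 (fact (n - 1) :: nat) = nu2 (fact n :: nat)"
  using nu2_mult[of n "fact (n - 1)"] by (simp add: fact_reduce[of n])

text \<open>Legendre's formula removes the factorials. What remains of the valuations is
  \<open>nu2 k - min (nu2 n) (nu2 m)\<close>, which is 0 because the minimum is
  \<open>nu2 (n + m)\<close>.\<close>

lemma nu2_Stirling_sigma2:
  assumes k: "0 < k" and n: "n = k + m" and m: "0 < m"
    and bit: "n mod 2 ^ Suc (nu2 m) < 2 ^ nu2 m"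
    and e: "2 * nu2 ((n + m) choose m) \<le> 2 ^ nu2 m"
    and nu: "nu2 (n + m) = nu2 k"
  shows "nu2 (Stirling n k) + sigma2 n = sigma2 k + nu2 ((n + m) choose m)"
proof -
  have "nu2 ((n + m - 1) choose m) = nu2 ((n + m) choose m) + (nu2 n - nu2 m)"
    using k n by (intro nu2_binomial_shift m bit) simp
  moreover have "nu2 (n + m) = min (nu2 n) (nu2 m)"
    using k n m by (intro nu2_add nu2_neq_if_bit_zero bit) simp_all
  ultimately show ?thesis
    using nu2_Stirling[OF k n m bit e] nu2_fact_pred[OF k] nu2_fact_pred[of n]
      nu2_fact[of n] nu2_fact[of k] k n nu by linarith
qed

section \<open>The hypotheses on b and c, and passage to the limit\<close>

lemma admissibleD:
  assumes "0 < b" and "b \<le> c" and "admissible b c"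
  shows "b < c" and "nu2 (2 * c - b) = nu2 b" and "even (c div 2 ^ nu2 (c - b))"
proof -
  have "b \<noteq> c" using assms by (auto simp: admissible_def)
  then have bc: "nu2 b \<le> nu2 c" "b < c"
    using assms by (auto simp: admissible_def)
  then show "b < c" by simp
  define v where "v = nu2 (c - b)"
  \<comment> \<open>2c has larger valuation than b, so its two summands b and 2c - b must have equal
    valuation.\<close>
  have "nu2 (2 * c - b) = nu2 b"
  proof -
    have c2: "nu2 (2 * c) = Suc (nu2 c)"
      using bc by (subst nu2_mult) simp_all
    have s: "2 * c = b + (2 * c - b)" "0 < 2 * c - b" using bc by simp_all
    show ?thesis
    proof (rule ccontr)
      assume "nu2 (2 * c - b) \<noteq> nu2 b"
      then have "nu2 (b + (2 * c - b)) = min (nu2 b) (nu2 (2 * c - b))"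
        using assms(1) s(2) by (intro nu2_add) auto
      then have "Suc (nu2 c) = min (nu2 b) (nu2 (2 * c - b))"
        unfolding s(1)[symmetric] c2 .
      then show False using bc by linarith
    qed
  qed
  then show "nu2 (2 * c - b) = nu2 b" .
  \<comment> \<open>In the first case v = \<open>nu2 b\<close> lies below all nonzero digits of c.
    In the second, adding an odd multiple of 2^v to b turns its digit 1 at position v into
    0.\<close>
  consider "nu2 b < nu2 c" | "2 ^ v \<in> binary_powers b"
    using assms(3) by (auto simp: admissible_def v_def)
  then have "even (c div 2 ^ v)"
  proof cases
    case 1
    have "v = nu2 b"
    proof (rule ccontr)
      assume "v \<noteq> nu2 b"
      then have "nu2 (b + (c - b)) = min (nu2 b) v"
        unfolding v_def using bc assms(1) by (intro nu2_add) auto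
      then show False using 1 bc by simp
    qed
    then have "2 ^ v * 2 dvd c"
      using 1 multiplicity_dvd'[of "Suc v" 2 c] by (simp add: mult.commute)
    then show ?thesis by (metis dvd_mult_imp_div mult.commute)
  next
    case 2
    then have "odd (b div 2 ^ v)"
      by (auto simp: binary_powers_def odd_iff_mod_2_eq_one)
    moreover obtain q where q: "c - b = 2 ^ v * q" "odd q"
      using multiplicity_decompose'[of "c - b" 2] bc by (auto simp: v_def)
    moreover have "c = b + 2 ^ v * q"
      using q(1) bc by linarith
    then have "c div 2 ^ v = b div 2 ^ v + q" by simp
    ultimately show ?thesis by simp
  qed
  then show "even (c div 2 ^ nu2 (c - b))" by (simp add: v_def)
qed

lemma bit_zero_shift:
  assumes "even (c div 2 ^ v)" and "L < 2 ^ h"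
  shows "(c * 2 ^ h + L) mod 2 ^ Suc (h + v) < (2 :: nat) ^ (h + v)"
proof -
  define n where "n = c * 2 ^ h + L"
  have "n div 2 ^ (h + v) = c div 2 ^ v"
    unfolding power_add div_mult2_eq n_def using assms(2) by simp
  then have "n mod 2 ^ Suc (h + v) = n mod 2 ^ (h + v)"
    using assms(1) mod_mult2_eq[of n "2 ^ (h + v)" 2] by (simp add: mult.commute)
  then show ?thesis by (simp add: n_def)
qed

text \<open>If L is nonzero, then \<open>nu2 L < h\<close>, so both valuations equal
  \<open>nu2 L\<close>.\<close>

lemma nu2_shift_add_cong:
  assumes "nu2 x = nu2 y" and "0 < x" and "0 < y" and "L < 2 ^ h"
  shows "nu2 (x * 2 ^ h + L) = nu2 (y * 2 ^ h + L)"
proof (cases "L = 0")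
  case True
  then show ?thesis using assms by (simp add: nu2_mult)
next
  case False
  have "nu2 L < h"
    using False assms(4) multiplicity_dvd[of 2 L]
    by (meson dvd_imp_le gr0I le_less_trans nat_power_less_imp_less pos2)
  then have "nu2 (z * 2 ^ h + L) = nu2 L" if "0 < z" for z
    using that False by (subst nu2_add) (auto simp: nu2_mult)
  then show ?thesis using assms by simp
qed

lemma nu2_Stirling_eq_limit_value:
  assumes "0 < b" and "b \<le> c" and "admissible b c" and "L < 2 ^ h"
    and "2 * nu2 ((2 * c - b) choose c) \<le> 2 ^ (h + nu2 (c - b))"
  shows "int (nu2 (Stirling (c * 2 ^ h + L) (b * 2 ^ h + L))) = limit_value b c"
proof -
  note adm = admissibleD[OF assms(1-3)]
  define n where "n = c * 2 ^ h + L"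
  define k where "k = b * 2 ^ h + L"
  define m where "m = (c - b) * 2 ^ h"
  have k: "0 < k" and m: "0 < m" and nk: "n = k + m"
    using assms(1,2) adm(1) by (simp_all add: k_def m_def n_def diff_mult_distrib)
  have nm: "n + m = (2 * c - b) * 2 ^ h + L"
  proof -
    have "2 * c - b = c + (c - b)" using adm(1) by simp
    then show ?thesis unfolding n_def m_def by (simp only: distrib_right add_ac)
  qed
  have nu_m: "nu2 m = h + nu2 (c - b)"
    using adm(1) by (simp add: m_def nu2_mult)
  have "nu2 ((n + m) choose m) + sigma2 (n + m) = sigma2 n + sigma2 m"
    using nu2_binomial[of m n] by (simp add: add.commute)
  moreover have "nu2 ((2 * c - b) choose c) + sigma2 (2 * c - b) = sigma2 c + sigma2 (c - b)"
    using nu2_binomial[of c "c - b"] adm(1) by (simp add: mult_2)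
  moreover have "sigma2 m = sigma2 (c - b)"
    using sigma2_concat[of 0 h "c - b"] by (simp add: m_def sigma2_def[of 0])
  \<comment> \<open>The digit sum of L occurs in both \<open>sigma2 (n + m)\<close> and
    \<open>sigma2 n\<close> and cancels.\<close>
  ultimately have e: "nu2 ((n + m) choose m) = nu2 ((2 * c - b) choose c)"
    unfolding nm unfolding n_def using assms(4) by (simp add: sigma2_concat)
  have "nu2 (Stirling n k) + sigma2 n = sigma2 k + nu2 ((n + m) choose m)"
  proof (rule nu2_Stirling_sigma2[OF k nk m])
    show "n mod 2 ^ Suc (nu2 m) < 2 ^ nu2 m"
      unfolding nu_m n_def by (rule bit_zero_shift[OF adm(3) assms(4)])
    show "2 * nu2 ((n + m) choose m) \<le> 2 ^ nu2 m"
      unfolding e nu_m by (rule assms(5))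
    show "nu2 (n + m) = nu2 k"
      unfolding nm k_def using adm(1,2) assms(1,4) by (intro nu2_shift_add_cong) simp_all
  qed
  then show ?thesis
    unfolding e unfolding n_def k_def limit_value_def using assms(4) by (simp add: sigma2_concat)
qed

theorem theorem3p4:
  fixes b c L :: nat
  assumes "0 < b" and "0 < c" and "b \<le> c"
    and "admissible b c"
  shows "((\<lambda>h. real (nu2 (Stirling (c * 2 ^ h + L) (b * 2 ^ h + L))))
            \<longlonglongrightarrow> real_of_int (limit_value b c)) \<and>
         (\<forall>h. L < 2 ^ h \<and>
              (2 :: real) powi (int h - 1 + int (nu2 (c - b))) \<ge> real (nu2 ((2 * c - b) choose c))
              \<longrightarrow> int (nu2 (Stirling (c * 2 ^ h + L) (b * 2 ^ h + L))) = limit_value b c)"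
proof
  define e where "e = nu2 ((2 * c - b) choose c)"
  note attained = nu2_Stirling_eq_limit_value[OF assms(1,3,4)]
  \<comment> \<open>The threshold L + 2e is crude: 2^h > h then exceeds both L and 2e.\<close>
  have "real_of_int (int (nu2 (Stirling (c * 2 ^ h + L) (b * 2 ^ h + L)))) =
      real_of_int (limit_value b c)" if "L + 2 * e \<le> h" for h
  proof -
    have "2 * e < 2 ^ h" "L < 2 ^ h"
      using that less_exp[of h] by linarith+
    moreover have "(2 :: nat) ^ h \<le> 2 ^ (h + nu2 (c - b))" by simp
    ultimately show ?thesis
      by (intro arg_cong[of _ _ real_of_int] attained) (unfold e_def, linarith+)
  qed
  then have "\<forall>\<^sub>F h in sequentially. real (nu2 (Stirling (c * 2 ^ h + L) (b * 2 ^ h + L))) =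
      real_of_int (limit_value b c)"
    unfolding eventually_sequentially by auto
  then show "(\<lambda>h. real (nu2 (Stirling (c * 2 ^ h + L) (b * 2 ^ h + L))))
      \<longlonglongrightarrow> real_of_int (limit_value b c)"
    by (rule tendsto_eventually)
  show "\<forall>h. L < 2 ^ h \<and>
      (2 :: real) powi (int h - 1 + int (nu2 (c - b))) \<ge> real (nu2 ((2 * c - b) choose c))
      \<longrightarrow> int (nu2 (Stirling (c * 2 ^ h + L) (b * 2 ^ h + L))) = limit_value b c"
  proof (intro allI impI attained; elim conjE)
    fix h
    assume "(2 :: real) powi (int h - 1 + int (nu2 (c - b))) \<ge> real (nu2 ((2 * c - b) choose c))"
    \<comment> \<open>The integer exponent is -1 if h and \<open>nu2 (c - b)\<close> are both 0;
      doubling the bound leads back to natural exponents.\<close>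
    moreover have "(2 :: real) powi (int h - 1 + int (nu2 (c - b))) = 2 ^ (h + nu2 (c - b)) / 2"
      by (simp add: power_int_diff power_int_add power_add)
    ultimately have "real (2 * nu2 ((2 * c - b) choose c)) \<le> real (2 ^ (h + nu2 (c - b)))"
      by simp
    then show "2 * nu2 ((2 * c - b) choose c) \<le> 2 ^ (h + nu2 (c - b))"
      by (simp only: of_nat_le_iff)
  qed
qed

end
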